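(* Let $n\geq 2$ be an integer, and let $\bm{a},\bm{b}\in\mathbb{R}^n$ satisfy $0\leq a_i<b_i$ for all $i=1,\ldots,n$ and $a_i=0$ for $i=1,\ldots,n-1$. Let \[ C_n^1=\operatorname{conv}\left\{(\bm{x},y)\in\mathbb{R}^{n}\times\mathbb{R} : a_i\leq x_i\leq b_i \text{ for all } i=1,\ldots,n,\ y=\prod_{i=1}^n x_i\right\}\subseteq\mathbb{R}^{n+1}. \] Then \[ \operatorname{vol}_{n+1}(C_n^1)=\frac{(b_n-a_n)\prod_{i=1}^{n-1}b_i^2}{(n+1)!}\,\Big((n!-1)\,b_n+\big((n-1)!-n\big)\,a_n\Big). \]
   Context: $\operatorname{conv}$ denotes the convex hull, and $\operatorname{vol}_{d}$ denotes $d$-dimensional volume (Lebesgue measure) on $\mathbb{R}^d$. $C_n^1$ is the convex hull of the graph of the monomial $x_1x_2\cdots x_n$ over the box $[\bm{a},\bm{b}]$, in the case where at most one variable (taken to be $x_n$) has a nonzero lower bound; $a_n=0$ is allowed. *)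

theory Defs
  imports "HOL-Analysis.Analysis"
begin

definition monomial_hull :: "real ^ 'n \<Rightarrow> real ^ 'n \<Rightarrow> ((real ^ 'n) \<times> real) set" where
  "monomial_hull a b =
     convex hull {(x, y). (\<forall>i. a $ i \<le> x $ i \<and> x $ i \<le> b $ i) \<and> y = (\<Prod>i\<in>UNIV. x $ i)}"

end

theory Submission
  imports Defs
begin

text \<open>
  Put \<open>x\<^sub>i = b\<^sub>i u\<^sub>i\<close> for \<open>i \<noteq> l\<close> and \<open>x\<^sub>l = \<alpha> + \<delta> u\<^sub>l\<close> with \<open>\<alpha> = a\<^sub>l\<close> and \<open>\<delta> = b\<^sub>l - a\<^sub>l\<close>. Then \<open>u\<close> runs
  through the unit cube, and up to the factor \<open>B = \<Prod>\<^bsub>i\<noteq>l\<^esub> b\<^sub>i\<close> the monomial becomes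
  \<open>\<alpha> \<Prod>\<^bsub>i\<noteq>l\<^esub> u\<^sub>i + \<delta> \<Prod>\<^bsub>i\<^esub> u\<^sub>i\<close>, a nonnegative combination of two monomials on the unit cube. This affine
  change of variables multiplies volumes by \<open>\<delta> B\<^sup>2\<close>.
  
  On the unit cube a monomial \<open>\<Prod>\<^bsub>i\<in>I\<^esub> u\<^sub>i\<close> lies between the two Frechet bounds, the convex function
  \<open>max 0 (1 - \<Sum>\<^bsub>i\<in>I\<^esub> (1 - u\<^sub>i))\<close> and the concave function \<open>min\<^bsub>i\<in>I\<^esub> u\<^sub>i\<close>. Envelopes of a sum are in general not the
  sums of the envelopes. Here they are (\<open>unit_hull_eq\<close>), since the same convex combination of points of the graph
  is optimal for both monomials. For the upper envelope it is the decomposition of \<open>u\<close> into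
  indicator vectors of its superlevel sets (\<open>upper_envelope_in_unit_hull\<close>), and for the lower envelope it
  is given explicitly in three regions of the cube (\<open>lower_envelope_in_unit_hull\<close>).
  
  The volume of the normalised hull is therefore the integral of the difference of the envelopes, and
  with \<open>k = |I|\<close> it remains to integrate the Frechet bounds: the minimum of \<open>k\<close> coordinates has mean
  \<open>1 / (k + 1)\<close>, because its superlevel sets are boxes, and the lower bound has mean
  \<open>1 / (k + 1)!\<close>, because the region below its graph is a corner simplex. With \<open>k = n - 1\<close> and \<open>k = n\<close>
  this gives
  \<open>\<delta> B\<^sup>2 (\<alpha> (1 / n - 1 / n!) + \<delta> (1 / (n + 1) - 1 / (n + 1)!))\<close>, which is the claimed value.
\<close>

section \<open>The Frechet bounds of a monomial on the unit cube\<close>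

text \<open>
  If \<open>u\<^sub>i\<close> are the probabilities of events, the next two functions are the sharp bounds for the
  probability that all events with index in \<open>I\<close> happen; a monomial is the case of independence.
\<close>

definition frechet_upper :: "'n set \<Rightarrow> real ^ 'n \<Rightarrow> real" where
  "frechet_upper I u = (MIN i\<in>I. u $ i)"

definition frechet_lower :: "'n set \<Rightarrow> real ^ 'n \<Rightarrow> real" where
  "frechet_lower I u = max 0 (1 - (\<Sum>i\<in>I. 1 - u $ i))"

lemma frechet_upper_le: "i \<in> I \<Longrightarrow> frechet_upper I u \<le> u $ i"
  for I :: "'n::finite set"
  by (simp add: frechet_upper_def)

lemma frechet_upper_greatest:
  fixes I :: "'n::finite set"
  assumes "I \<noteq> {}" "\<And>i. i \<in> I \<Longrightarrow> c \<le> u $ i"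
  shows "c \<le> frechet_upper I u"
  using assms by (simp add: frechet_upper_def)

lemma frechet_upper_eqI:
  fixes I :: "'n::finite set"
  assumes "i \<in> I" "\<And>j. j \<in> I \<Longrightarrow> u $ i \<le> u $ j"
  shows "frechet_upper I u = u $ i"
  unfolding frechet_upper_def using assms by (intro Min_eqI) auto

lemma frechet_upper_attained:
  fixes I :: "'n::finite set"
  assumes "I \<noteq> {}"
  obtains i where "i \<in> I" "frechet_upper I u = u $ i"
proof -
  have "frechet_upper I u \<in> (\<lambda>i. u $ i) ` I"
    unfolding frechet_upper_def using assms by (intro Min_in) auto
  thus ?thesis using that by auto
qed

lemma mem_unit_cube: "u \<in> cbox 0 (1 :: real ^ 'n) \<longleftrightarrow> (\<forall>i. 0 \<le> u $ i \<and> u $ i \<le> 1)"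
  by (simp add: mem_box_cart)

text \<open>
  The lower bound is the Weierstrass product inequality applied to \<open>1 - u\<^sub>i\<close>; the upper bound drops all
  factors but the smallest.
\<close>

lemma frechet_bounds:
  fixes I :: "'n::finite set"
  assumes u: "u \<in> cbox 0 1"
  shows "frechet_lower I u \<le> (\<Prod>i\<in>I. u $ i)"
    and "I \<noteq> {} \<Longrightarrow> (\<Prod>i\<in>I. u $ i) \<le> frechet_upper I u"
proof -
  have 01: "0 \<le> u $ i" "u $ i \<le> 1" for i using u by (auto simp: mem_unit_cube)
  have "1 - (\<Sum>i\<in>I. 1 - u $ i) \<le> (\<Prod>i\<in>I. 1 - (1 - u $ i))"
    by (rule Weierstrass_prod_ineq) (use 01 in auto)
  moreover have "0 \<le> (\<Prod>i\<in>I. u $ i)" using 01 by (simp add: prod_nonneg)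
  ultimately show "frechet_lower I u \<le> (\<Prod>i\<in>I. u $ i)"
    by (simp add: frechet_lower_def)
  show "(\<Prod>i\<in>I. u $ i) \<le> frechet_upper I u" if "I \<noteq> {}"
  proof (rule frechet_upper_greatest[OF that])
    fix i assume i: "i \<in> I"
    have "(\<Prod>i\<in>I. u $ i) = u $ i * (\<Prod>j\<in>I - {i}. u $ j)"
      using i by (simp add: prod.remove)
    also have "\<dots> \<le> u $ i * 1"
      by (intro mult_left_mono prod_le_1) (use 01 in auto)
    finally show "(\<Prod>i\<in>I. u $ i) \<le> u $ i" by simp
  qed
qed

lemma concave_on_frechet_upper:
  fixes I :: "'n::finite set"
  assumes "I \<noteq> {}"
  shows "concave_on (cbox 0 1) (frechet_upper I)"
proof (unfold concave_on_iff, intro conjI ballI allI impI)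
  fix x y :: "real ^ 'n" and s t :: real
  assume st: "0 \<le> s" "0 \<le> t"
  show "s * frechet_upper I x + t * frechet_upper I y \<le> frechet_upper I (s *\<^sub>R x + t *\<^sub>R y)"
    by (rule frechet_upper_greatest[OF assms])
      (use st in \<open>auto intro!: add_mono mult_left_mono frechet_upper_le\<close>)
qed (rule convex_box)

lemma convex_on_frechet_lower:
  fixes I :: "'n::finite set"
  shows "convex_on (cbox 0 1) (frechet_lower I)"
proof (unfold convex_on_def, intro conjI ballI allI impI)
  fix x y :: "real ^ 'n" and s t :: real
  assume st: "0 \<le> s" "0 \<le> t" "s + t = 1"
  define A where "A u = 1 - (\<Sum>i\<in>I. 1 - u $ i)" for u :: "real ^ 'n"
  have "(\<Sum>i\<in>I. 1 - (s *\<^sub>R x + t *\<^sub>R y) $ i) = (\<Sum>i\<in>I. s * (1 - x $ i) + t * (1 - y $ i))"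
    by (rule sum.cong) (use st in \<open>simp_all add: algebra_simps\<close>)
  hence "A (s *\<^sub>R x + t *\<^sub>R y) = (s + t) - (s * (\<Sum>i\<in>I. 1 - x $ i) + t * (\<Sum>i\<in>I. 1 - y $ i))"
    using st(3) by (simp only: A_def sum.distrib sum_distrib_left)
  hence "A (s *\<^sub>R x + t *\<^sub>R y) = s * A x + t * A y"
    by (simp add: A_def algebra_simps)
  also have "\<dots> \<le> s * max 0 (A x) + t * max 0 (A y)"
    using st by (intro add_mono mult_left_mono) auto
  finally show "frechet_lower I (s *\<^sub>R x + t *\<^sub>R y) \<le> s * frechet_lower I x + t * frechet_lower I y"
    using st by (simp add: frechet_lower_def A_def)
qed (rule convex_box)

section \<open>The normalised hull and its envelopes\<close>

text \<open>
  The normal form of the monomial on the box, up to a constant factor: \<open>\<alpha>\<close> is the lower bound of the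
  distinguished variable and \<open>\<delta>\<close> the length of its interval.
\<close>

definition monomial_pair :: "'n::finite \<Rightarrow> real \<Rightarrow> real \<Rightarrow> real ^ 'n \<Rightarrow> real" where
  "monomial_pair l \<alpha> \<delta> u = \<alpha> * (\<Prod>i\<in>-{l}. u $ i) + \<delta> * (\<Prod>i\<in>UNIV. u $ i)"

definition upper_envelope :: "'n::finite \<Rightarrow> real \<Rightarrow> real \<Rightarrow> real ^ 'n \<Rightarrow> real" where
  "upper_envelope l \<alpha> \<delta> u = \<alpha> * frechet_upper (-{l}) u + \<delta> * frechet_upper UNIV u"

definition lower_envelope :: "'n::finite \<Rightarrow> real \<Rightarrow> real \<Rightarrow> real ^ 'n \<Rightarrow> real" where
  "lower_envelope l \<alpha> \<delta> u = \<alpha> * frechet_lower (-{l}) u + \<delta> * frechet_lower UNIV u"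

definition unit_hull :: "'n::finite \<Rightarrow> real \<Rightarrow> real \<Rightarrow> ((real ^ 'n) \<times> real) set" where
  "unit_hull l \<alpha> \<delta> = convex hull ((\<lambda>u. (u, monomial_pair l \<alpha> \<delta> u)) ` cbox 0 1)"

lemma graph_in_unit_hull:
  assumes "\<And>i. 0 \<le> u $ i" "\<And>i. u $ i \<le> 1"
  shows "(u, monomial_pair l \<alpha> \<delta> u) \<in> unit_hull l \<alpha> \<delta>"
  unfolding unit_hull_def
  by (rule hull_inc) (use assms in \<open>auto simp: mem_unit_cube\<close>)

lemma convex_unit_hull: "convex (unit_hull l \<alpha> \<delta>)"
  by (simp add: unit_hull_def)

text \<open>
  The region between a convex lower and a concave upper bound is convex, so it contains the hull as
  soon as it contains the graph.
\<close>

lemma unit_hull_subset: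
  fixes l :: "'n::finite"
  assumes "-{l} \<noteq> {}" "0 \<le> \<alpha>" "0 \<le> \<delta>"
  shows "unit_hull l \<alpha> \<delta> \<subseteq>
    {(u, y). u \<in> cbox 0 1 \<and> lower_envelope l \<alpha> \<delta> u \<le> y \<and> y \<le> upper_envelope l \<alpha> \<delta> u}" (is "_ \<subseteq> ?R")
  unfolding unit_hull_def
proof (rule hull_minimal)
  show "(\<lambda>u. (u, monomial_pair l \<alpha> \<delta> u)) ` cbox 0 1 \<subseteq> ?R"
    using assms
    by (auto simp: monomial_pair_def lower_envelope_def upper_envelope_def
        intro!: add_mono mult_left_mono frechet_bounds)
  have cx: "convex_on (cbox 0 1) (lower_envelope l \<alpha> \<delta>)"
    unfolding lower_envelope_def using assms
    by (intro convex_on_add convex_on_cmul convex_on_frechet_lower)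
  have cc: "concave_on (cbox 0 1) (upper_envelope l \<alpha> \<delta>)"
    unfolding upper_envelope_def using assms
    by (intro concave_on_add concave_on_cmul concave_on_frechet_upper) auto
  show "convex ?R"
  proof (rule convexI)
    fix p q and s t :: real
    assume p: "p \<in> ?R" and q: "q \<in> ?R" and st: "0 \<le> s" "0 \<le> t" "s + t = 1"
    obtain u y v z where [simp]: "p = (u, y)" "q = (v, z)" by fastforce
    have "s *\<^sub>R u + t *\<^sub>R v \<in> cbox 0 1"
      using p q st convex_box[of 0 "1 :: real ^ 'n"] by (auto simp: convex_def)
    moreover have "lower_envelope l \<alpha> \<delta> (s *\<^sub>R u + t *\<^sub>R v) \<le> s * y + t * z"
    proof -
      have "lower_envelope l \<alpha> \<delta> (s *\<^sub>R u + t *\<^sub>R v)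
          \<le> s * lower_envelope l \<alpha> \<delta> u + t * lower_envelope l \<alpha> \<delta> v"
        using cx p q st by (auto simp: convex_on_def)
      also have "\<dots> \<le> s * y + t * z"
        using p q st by (auto intro!: add_mono mult_left_mono)
      finally show ?thesis .
    qed
    moreover have "s * y + t * z \<le> upper_envelope l \<alpha> \<delta> (s *\<^sub>R u + t *\<^sub>R v)"
    proof -
      have "s * y + t * z \<le> s * upper_envelope l \<alpha> \<delta> u + t * upper_envelope l \<alpha> \<delta> v"
        using p q st by (auto intro!: add_mono mult_left_mono)
      also have "\<dots> \<le> upper_envelope l \<alpha> \<delta> (s *\<^sub>R u + t *\<^sub>R v)"
        using cc p q st by (auto simp: concave_on_iff)
      finally show ?thesis .
    qed
    ultimately show "s *\<^sub>R p + t *\<^sub>R q \<in> ?R" by simp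
  qed
qed

lemma monomial_pair_eq_0:
  assumes "i \<noteq> l" "u $ i = 0"
  shows "monomial_pair l \<alpha> \<delta> u = 0"
proof -
  have "(\<Prod>i\<in>-{l}. u $ i) = 0" "(\<Prod>i\<in>UNIV. u $ i) = 0"
    using assms by (auto intro!: prod_zero bexI[of _ i])
  thus ?thesis by (simp only: monomial_pair_def mult_zero_right add_0_left)
qed

section \<open>The upper envelope\<close>


definition support_indicator :: "real ^ 'n \<Rightarrow> real ^ 'n" where
  "support_indicator u = (\<chi> i. if u $ i = 0 then 0 else 1)"

text \<open>
  Subtracting a constant \<open>c\<close> from all nonzero coordinates lowers the minimum over \<open>I\<close> by \<open>c\<close>, unless the
  minimum is \<open>0\<close> already. In both cases the loss is \<open>c\<close> times the monomial at the indicator vector of the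
  support, and this for every \<open>I\<close> with the same vector.
\<close>

lemma frechet_upper_peel:
  fixes I :: "'n::finite set"
  assumes "I \<noteq> {}" "\<And>i. 0 \<le> u $ i" "0 \<le> c" "\<And>i. u $ i \<noteq> 0 \<Longrightarrow> c \<le> u $ i"
  shows "frechet_upper I u =
    c * (\<Prod>i\<in>I. support_indicator u $ i) + frechet_upper I (u - c *\<^sub>R support_indicator u)"
proof -
  obtain i where i: "i \<in> I" "frechet_upper I u = u $ i"
    using frechet_upper_attained[OF assms(1)] .
  have le: "u $ i \<le> u $ j" if "j \<in> I" for j
    using frechet_upper_le[OF that, of u] i by simp
  have eq: "frechet_upper I (u - c *\<^sub>R support_indicator u) = (u - c *\<^sub>R support_indicator u) $ i"
  proof (rule frechet_upper_eqI[OF i(1)])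
    fix j assume j: "j \<in> I"
    show "(u - c *\<^sub>R support_indicator u) $ i \<le> (u - c *\<^sub>R support_indicator u) $ j"
      using le[OF j] assms(2)[of i] assms(4)[of i] assms(4)[of j] by (auto simp: support_indicator_def)
  qed
  show ?thesis
  proof (cases "u $ i = 0")
    case True
    hence "(\<Prod>i\<in>I. support_indicator u $ i) = 0"
      using i(1) by (intro prod_zero) (auto simp: support_indicator_def intro!: bexI[of _ i])
    thus ?thesis using True i eq by (simp add: support_indicator_def)
  next
    case False
    hence "u $ j \<noteq> 0" if "j \<in> I" for j using le[OF that] assms(2)[of i] by auto
    hence "(\<Prod>i\<in>I. support_indicator u $ i) = 1"
      by (intro prod.neutral) (auto simp: support_indicator_def)
    thus ?thesis using False i eq by (simp add: support_indicator_def)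
  qed
qed

text \<open>
  Peeling off one level set at a time writes \<open>u\<close> as a combination of indicator vectors with total
  weight at most \<open>r\<close>; along it the upper envelope is the same combination of values of the graph, being the
  Lovasz extension of its values at the vertices. The factor \<open>r\<close> is what makes the induction work: after a step of height \<open>c\<close> the remaining vector
  is bounded by \<open>r - c\<close> only, and the two pieces recombine by convexity. The missing weight is put at the origin,
  where the graph has height \<open>0\<close> because there is a coordinate other than \<open>l\<close>.
\<close>

lemma upper_envelope_in_scaled_hull:
  fixes l :: "'n::finite"
  assumes "-{l} \<noteq> {}" "\<And>i. 0 \<le> u $ i" "\<And>i. u $ i \<le> r"
  shows "\<exists>h\<in>unit_hull l \<alpha> \<delta>. (u, upper_envelope l \<alpha> \<delta> u) = r *\<^sub>R h"
  using assms
proof (induction "card {i. u $ i \<noteq> 0}" arbitrary: u r rule: less_induct)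
  case less
  show ?case
  proof (cases "u = 0")
    case True
    obtain j where j: "j \<in> -{l}" using less.prems(1) by blast
    have z: "frechet_upper I (0 :: real ^ 'n) = 0" if "j \<in> I" for I
      using frechet_upper_eqI[OF that, of 0] by simp
    have "(0, monomial_pair l \<alpha> \<delta> 0) \<in> unit_hull l \<alpha> \<delta>"
      by (rule graph_in_unit_hull) auto
    moreover have "monomial_pair l \<alpha> \<delta> 0 = 0"
      by (rule monomial_pair_eq_0[of j]) (use j in auto)
    moreover have "upper_envelope l \<alpha> \<delta> 0 = 0"
      by (simp only: upper_envelope_def z[OF j] z[OF UNIV_I])
    ultimately show ?thesis
      using True by (metis scaleR_zero_right zero_prod_def)
  next
    case False
    define S where "S = {i. u $ i \<noteq> 0}"
    define c where "c = (MIN i\<in>S. u $ i)"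
    have S: "S \<noteq> {}" using False by (auto simp: S_def vec_eq_iff)
    have "c \<in> (\<lambda>i. u $ i) ` S" unfolding c_def using S by (intro Min_in) auto
    then obtain k where k: "k \<in> S" "c = u $ k" by auto
    have cle: "c \<le> u $ i" if "u $ i \<noteq> 0" for i
      using that by (auto simp: c_def S_def intro!: Min_le)
    have c: "0 < c" using k less.prems(2)[of k] by (auto simp: S_def)
    have r: "c \<le> r" using k less.prems(3)[of k] by simp
    define v where "v = u - c *\<^sub>R support_indicator u"
    have v: "0 \<le> v $ i" "v $ i \<le> r - c" for i
      using less.prems(2,3)[of i] cle[of i] r by (auto simp: v_def support_indicator_def)
    have "card {i. v $ i \<noteq> 0} < card {i. u $ i \<noteq> 0}"
    proof (rule psubset_card_mono)
      have "v $ i = 0" if "u $ i = 0" for i using that by (simp add: v_def support_indicator_def)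
      moreover have "v $ k = 0" "u $ k \<noteq> 0"
        using k by (simp_all add: v_def support_indicator_def S_def)
      ultimately show "{i. v $ i \<noteq> 0} \<subset> {i. u $ i \<noteq> 0}" by blast
    qed simp
    from less.hyps[OF this less.prems(1) v] obtain h2
      where h2: "h2 \<in> unit_hull l \<alpha> \<delta>" "(v, upper_envelope l \<alpha> \<delta> v) = (r - c) *\<^sub>R h2" by blast
    define h1 where "h1 = (support_indicator u, monomial_pair l \<alpha> \<delta> (support_indicator u))"
    have h1: "h1 \<in> unit_hull l \<alpha> \<delta>"
      unfolding h1_def by (rule graph_in_unit_hull) (auto simp: support_indicator_def)
    have peel: "frechet_upper I u = c * (\<Prod>i\<in>I. support_indicator u $ i) + frechet_upper I v" if "I \<noteq> {}" for I
      unfolding v_def using that less.prems(2) c cle by (intro frechet_upper_peel) auto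
    have "upper_envelope l \<alpha> \<delta> u = c * monomial_pair l \<alpha> \<delta> (support_indicator u) + upper_envelope l \<alpha> \<delta> v"
      unfolding upper_envelope_def monomial_pair_def peel[OF less.prems(1)] peel[OF UNIV_not_empty]
      by (simp add: algebra_simps)
    hence "(u, upper_envelope l \<alpha> \<delta> u) = c *\<^sub>R h1 + (v, upper_envelope l \<alpha> \<delta> v)"
      by (simp add: h1_def v_def)
    also have "\<dots> = r *\<^sub>R ((c / r) *\<^sub>R h1 + ((r - c) / r) *\<^sub>R h2)"
      unfolding h2(2) using c r by (simp add: scaleR_add_right)
    finally have "(u, upper_envelope l \<alpha> \<delta> u) = r *\<^sub>R ((c / r) *\<^sub>R h1 + ((r - c) / r) *\<^sub>R h2)" .
    moreover have "(c / r) *\<^sub>R h1 + ((r - c) / r) *\<^sub>R h2 \<in> unit_hull l \<alpha> \<delta>"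
      by (rule convexD[OF convex_unit_hull h1 h2(1)]) (use c r in \<open>simp_all flip: add_divide_distrib\<close>)
    ultimately show ?thesis by blast
  qed
qed

lemma upper_envelope_in_unit_hull:
  fixes l :: "'n::finite"
  assumes "-{l} \<noteq> {}" "u \<in> cbox 0 1"
  shows "(u, upper_envelope l \<alpha> \<delta> u) \<in> unit_hull l \<alpha> \<delta>"
  using upper_envelope_in_scaled_hull[OF assms(1), of u 1] assms(2) by (auto simp: mem_unit_cube)

section \<open>The lower envelope\<close>

text \<open>
  Write \<open>v = 1 - u\<close> and \<open>V = \<Sum>\<^bsub>i\<noteq>l\<^esub> v\<^sub>i\<close>, so that the envelope is \<open>\<alpha> max 0 (1 - V) + \<delta> max 0 (1 - v\<^sub>l - V)\<close>. Each
  of the three regions where it is affine has its own optimal combination of points of the graph: as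
  much weight as possible is put on points with a zero coordinate other than \<open>l\<close>, where the graph has height \<open>0\<close>,
  and after that on points with \<open>u\<^sub>l = 0\<close>, where only the first monomial can be nonzero.
\<close>

lemma lower_envelope_in_unit_hull:
  fixes l :: "'n::finite"
  assumes "u \<in> cbox 0 1"
  shows "(u, lower_envelope l \<alpha> \<delta> u) \<in> unit_hull l \<alpha> \<delta>"
proof -
  have 01: "0 \<le> u $ i" "u $ i \<le> 1" for i using assms by (auto simp: mem_unit_cube)
  define v where "v i = 1 - u $ i" for i
  have v: "0 \<le> v i" "v i \<le> 1" for i using 01 by (auto simp: v_def)
  define V where "V = (\<Sum>i\<in>-{l}. v i)"
  have V: "0 \<le> V" using v by (simp add: V_def sum_nonneg)
  have sumU: "(\<Sum>i\<in>UNIV. v i) = v l + V"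
    by (simp add: V_def sum.remove[of UNIV l] Compl_eq_Diff_UNIV)
  have env: "lower_envelope l \<alpha> \<delta> u = \<alpha> * max 0 (1 - V) + \<delta> * max 0 (1 - v l - V)"
    by (simp add: lower_envelope_def frechet_lower_def sumU[unfolded v_def] V_def v_def algebra_simps)
  consider "V + v l \<le> 1" | "V \<le> 1" "1 < V + v l" | "1 < V" by linarith
  thus ?thesis
  proof cases
    case 1
    \<comment> \<open>Near the all-ones vertex: its neighbour along axis \<open>i\<close> (index \<open>Some i\<close>) gets weight \<open>v\<^sub>i\<close>,
      and the vertex itself (index \<open>None\<close>) the remaining weight.\<close>
    define z where "z k = (\<chi> i::'n. if k = Some i then 0 else (1::real))" for k
    define w where "w k = (case k of None \<Rightarrow> 1 - v l - V | Some i \<Rightarrow> v i)" for k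
    define m where "m k = monomial_pair l \<alpha> \<delta> (z k)" for k
    have sum_opt: "(\<Sum>k\<in>UNIV. f k) = f None + (f (Some l) + (\<Sum>i\<in>-{l}. f (Some i)))"
      for f :: "'n option \<Rightarrow> real"
      by (simp add: UNIV_option_conv sum.reindex sum.remove[of UNIV l] Compl_eq_Diff_UNIV)
    have "(\<Sum>k\<in>UNIV. w k *\<^sub>R (z k, m k)) \<in> unit_hull l \<alpha> \<delta>"
    proof (rule convex_sum)
      show "(\<Sum>k\<in>UNIV. w k) = 1" by (simp add: sum_opt w_def V_def)
      show "(z k, m k) \<in> unit_hull l \<alpha> \<delta>" for k
        unfolding m_def by (rule graph_in_unit_hull) (auto simp: z_def)
    qed (use v 1 in \<open>auto simp: w_def convex_unit_hull split: option.split\<close>)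
    moreover have "(\<Sum>k\<in>UNIV. w k *\<^sub>R z k) = u"
    proof (rule vec_eq_iff[THEN iffD2], intro allI)
      fix j
      have "(\<Sum>k\<in>UNIV. w k *\<^sub>R z k) $ j = (\<Sum>k\<in>UNIV. w k * z k $ j)" by simp
      also have "\<dots> = (\<Sum>k\<in>UNIV. w k - (if k = Some j then v j else 0))"
        by (rule sum.cong) (auto simp: z_def w_def)
      also have "\<dots> = (\<Sum>k\<in>UNIV. w k) - v j"
        by (simp add: sum_subtractf sum.delta)
      also have "(\<Sum>k\<in>UNIV. w k) = 1" by (simp add: sum_opt w_def V_def)
      finally show "(\<Sum>k\<in>UNIV. w k *\<^sub>R z k) $ j = u $ j" by (simp add: v_def)
    qed
    moreover have "(\<Sum>k\<in>UNIV. w k * m k) = lower_envelope l \<alpha> \<delta> u"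
    proof -
      have "m None = \<alpha> + \<delta>" by (simp add: m_def z_def monomial_pair_def)
      moreover have "m (Some l) = \<alpha>"
      proof -
        have "(\<Prod>i\<in>UNIV. z (Some l) $ i) = 0" by (rule prod_zero) (auto simp: z_def)
        moreover have "(\<Prod>i\<in>-{l}. z (Some l) $ i) = 1" by (rule prod.neutral) (auto simp: z_def)
        ultimately show ?thesis by (simp add: m_def monomial_pair_def)
      qed
      moreover have "m (Some i) = 0" if "i \<in> -{l}" for i
        using that unfolding m_def by (intro monomial_pair_eq_0[of i]) (auto simp: z_def)
      ultimately show ?thesis
        using 1 v[of l] by (simp add: sum_opt w_def env max_def algebra_simps)
    qed
    ultimately show ?thesis by (simp add: sum_prod)
  next
    case 2
    \<comment> \<open>Index \<open>l\<close> stands for the vertex where only coordinate \<open>l\<close> vanishes, with weight \<open>1 - V\<close>. The other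
      points share the value \<open>\<theta>\<close> of coordinate \<open>l\<close>, chosen so that its mean \<open>\<theta> V\<close> is \<open>u\<^sub>l\<close>. Here
      \<open>V > 0\<close> because \<open>v\<^sub>l \<le> 1\<close>.\<close>
    define \<theta> where "\<theta> = u $ l / V"
    have \<theta>: "0 \<le> \<theta>" "\<theta> \<le> 1" "\<theta> * V = u $ l"
      using 2 01[of l] V by (auto simp: \<theta>_def v_def divide_le_eq)
    define z where "z k = (\<chi> i::'n. if i = l then (if k = l then 0 else \<theta>) else if i = k then 0 else (1::real))" for k
    define w where "w k = (if k = l then 1 - V else v k)" for k
    define m where "m k = monomial_pair l \<alpha> \<delta> (z k)" for k
    have sum_l: "(\<Sum>k\<in>UNIV. f k) = f l + (\<Sum>i\<in>-{l}. f i)" for f :: "'n \<Rightarrow> real"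
      by (simp add: sum.remove[of UNIV l] Compl_eq_Diff_UNIV)
    have w1: "(\<Sum>k\<in>UNIV. w k) = 1" by (simp add: sum_l w_def V_def)
    have "(\<Sum>k\<in>UNIV. w k *\<^sub>R (z k, m k)) \<in> unit_hull l \<alpha> \<delta>"
    proof (rule convex_sum[OF _ convex_unit_hull w1])
      show "(z k, m k) \<in> unit_hull l \<alpha> \<delta>" for k
        unfolding m_def by (rule graph_in_unit_hull) (use \<theta> in \<open>auto simp: z_def\<close>)
    qed (use v 2 in \<open>auto simp: w_def\<close>)
    moreover have "(\<Sum>k\<in>UNIV. w k *\<^sub>R z k) = u"
    proof (rule vec_eq_iff[THEN iffD2], intro allI)
      fix j
      have "(\<Sum>k\<in>UNIV. w k *\<^sub>R z k) $ j = (\<Sum>k\<in>UNIV. w k * z k $ j)" by simp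
      also have "\<dots> = u $ j"
      proof (cases "j = l")
        case True
        have "(\<Sum>k\<in>UNIV. w k * z k $ l) = w l * z l $ l + (\<Sum>i\<in>-{l}. w i * z i $ l)"
          by (simp only: sum_l[of "\<lambda>k. w k * z k $ l"])
        also have "(\<Sum>i\<in>-{l}. w i * z i $ l) = (\<Sum>i\<in>-{l}. v i * \<theta>)"
          by (rule sum.cong) (auto simp: w_def z_def)
        also have "\<dots> = V * \<theta>"
          by (simp only: V_def sum_distrib_right)
        also have "\<dots> = u $ l" using \<theta>(3) by (simp add: mult.commute)
        finally show ?thesis using True by (simp add: z_def)
      next
        case False
        have "(\<Sum>k\<in>UNIV. w k * z k $ j) = (\<Sum>k\<in>UNIV. w k - (if k = j then v j else 0))"
          by (rule sum.cong) (use False in \<open>auto simp: z_def w_def\<close>)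
        also have "\<dots> = (\<Sum>k\<in>UNIV. w k) - v j"
          by (simp add: sum_subtractf sum.delta)
        finally show ?thesis by (simp add: v_def w1)
      qed
      finally show "(\<Sum>k\<in>UNIV. w k *\<^sub>R z k) $ j = u $ j" .
    qed
    moreover have "(\<Sum>k\<in>UNIV. w k * m k) = lower_envelope l \<alpha> \<delta> u"
    proof -
      have "m l = \<alpha>"
      proof -
        have "(\<Prod>i\<in>UNIV. z l $ i) = 0" by (rule prod_zero) (auto simp: z_def)
        moreover have "(\<Prod>i\<in>-{l}. z l $ i) = 1" by (rule prod.neutral) (auto simp: z_def)
        ultimately show ?thesis by (simp add: m_def monomial_pair_def)
      qed
      moreover have "m i = 0" if "i \<in> -{l}" for i
        using that unfolding m_def by (intro monomial_pair_eq_0[of i]) (auto simp: z_def)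
      ultimately show ?thesis
        using 2 by (simp add: sum_l w_def env max_def algebra_simps)
    qed
    ultimately show ?thesis by (simp add: sum_prod)
  next
    case 3
    \<comment> \<open>The envelope is \<open>0\<close>, so every point used has a zero coordinate \<open>k \<noteq> l\<close>. The weights are \<open>v\<close> scaled
      to total \<open>1\<close>; coordinate \<open>j\<close> is present with weight \<open>1 - w j\<close> and enlarged accordingly. It stays below
      \<open>1\<close> because \<open>w j \<le> v j\<close>, and if \<open>w j = 1\<close> then \<open>u\<^sub>j = 0\<close>, where division by zero does no harm.\<close>
    define w where "w k = v k / V" for k
    have w: "0 \<le> w k" "w k \<le> v k" for k
      using 3 v[of k] by (auto simp: w_def divide_le_eq mult_le_cancel_left1)
    have w1: "(\<Sum>k\<in>-{l}. w k) = 1"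
      using 3 by (simp add: w_def V_def flip: sum_divide_distrib)
    define z where "z k = (\<chi> i::'n. if i = l then u $ l else if i = k then 0 else u $ i / (1 - w i))" for k
    have wle1: "w k \<le> 1" for k using w(2)[of k] v(2)[of k] by linarith
    have "(\<Sum>k\<in>-{l}. w k *\<^sub>R (z k, 0)) \<in> unit_hull l \<alpha> \<delta>"
    proof (rule convex_sum[OF _ convex_unit_hull w1])
      fix k assume k: "k \<in> -{l}"
      have "0 \<le> u $ i / (1 - w i) \<and> u $ i / (1 - w i) \<le> 1" for i
      proof -
        have "u $ i \<le> 1 - w i" using w(2)[of i] by (simp add: v_def)
        thus ?thesis using 01(1)[of i] wle1[of i]
          by (cases "w i = 1") (simp_all add: divide_le_eq_1)
      qed
      hence "(z k, monomial_pair l \<alpha> \<delta> (z k)) \<in> unit_hull l \<alpha> \<delta>"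
        using 01 by (intro graph_in_unit_hull) (simp_all add: z_def)
      moreover have "monomial_pair l \<alpha> \<delta> (z k) = 0"
        using k by (intro monomial_pair_eq_0[of k]) (auto simp: z_def)
      ultimately show "(z k, 0) \<in> unit_hull l \<alpha> \<delta>" by simp
    qed (use w in auto)
    moreover have "(\<Sum>k\<in>-{l}. w k *\<^sub>R z k) = u"
    proof (rule vec_eq_iff[THEN iffD2], intro allI)
      fix j
      have "(\<Sum>k\<in>-{l}. w k *\<^sub>R z k) $ j = (\<Sum>k\<in>-{l}. w k * z k $ j)" by simp
      also have "\<dots> = u $ j"
      proof (cases "j = l")
        case True
        thus ?thesis using w1 by (simp add: z_def flip: sum_distrib_right)
      next
        case False
        define q where "q = u $ j / (1 - w j)"
        have "(\<Sum>k\<in>-{l}. w k * z k $ j) = (\<Sum>k\<in>-{l}. w k * q - (if k = j then w j * q else 0))"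
          by (rule sum.cong) (use False in \<open>auto simp: z_def q_def\<close>)
        also have "\<dots> = (\<Sum>k\<in>-{l}. w k * q) - w j * q"
          using False by (simp add: sum_subtractf sum.delta)
        also have "(\<Sum>k\<in>-{l}. w k * q) = q"
          by (simp add: w1 flip: sum_distrib_right)
        also have "q - w j * q = (1 - w j) * q"
          by (simp add: left_diff_distrib)
        also have "\<dots> = u $ j"
          using w(2)[of j] 01[of j] by (cases "w j = 1") (auto simp: v_def q_def)
        finally show ?thesis .
      qed
      finally show "(\<Sum>k\<in>-{l}. w k *\<^sub>R z k) $ j = u $ j" .
    qed
    moreover have "lower_envelope l \<alpha> \<delta> u = 0"
      using 3 v[of l] by (simp add: env)
    ultimately show ?thesis by (simp add: sum_prod)
  qed
qed

lemma unit_hull_eq: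
  fixes l :: "'n::finite"
  assumes "-{l} \<noteq> {}" "0 \<le> \<alpha>" "0 \<le> \<delta>"
  shows "unit_hull l \<alpha> \<delta> =
    {(u, y). u \<in> cbox 0 1 \<and> lower_envelope l \<alpha> \<delta> u \<le> y \<and> y \<le> upper_envelope l \<alpha> \<delta> u}"
proof (rule equalityI[OF unit_hull_subset[OF assms]], clarify)
  fix u :: "real ^ 'n" and y
  assume u: "u \<in> cbox 0 1"
    and y: "lower_envelope l \<alpha> \<delta> u \<le> y" "y \<le> upper_envelope l \<alpha> \<delta> u"
  have "y \<in> closed_segment (lower_envelope l \<alpha> \<delta> u) (upper_envelope l \<alpha> \<delta> u)"
    using y by (auto simp: closed_segment_eq_real_ivl)
  then obtain t where t: "0 \<le> t" "t \<le> 1"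
    "y = (1 - t) * lower_envelope l \<alpha> \<delta> u + t * upper_envelope l \<alpha> \<delta> u"
    by (auto simp: closed_segment_def)
  have "(1 - t) *\<^sub>R (u, lower_envelope l \<alpha> \<delta> u) + t *\<^sub>R (u, upper_envelope l \<alpha> \<delta> u) \<in> unit_hull l \<alpha> \<delta>"
    using t u assms
    by (intro convexD[OF convex_unit_hull] lower_envelope_in_unit_hull upper_envelope_in_unit_hull) auto
  thus "(u, y) \<in> unit_hull l \<alpha> \<delta>"
    using t by (simp flip: scaleR_add_left)
qed

section \<open>Coordinate changes of Lebesgue measure\<close>


lemma Basis_vec_real:
  "(Basis :: ((real ^ 'n) \<times> real) set) = insert (0, 1) (range (\<lambda>i. (axis i 1, 0)))"
  by (auto simp: Basis_prod_def Basis_vec_def)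

lemma
  fixes f g :: "_ \<Rightarrow> real"
  shows sum_Basis_vec_real:
    "(\<Sum>j\<in>(Basis :: ((real ^ 'n) \<times> real) set). f j) = (\<Sum>i\<in>UNIV. f (axis i 1, 0)) + f (0, 1)"
  and prod_Basis_vec_real:
    "(\<Prod>j\<in>(Basis :: ((real ^ 'n) \<times> real) set). g j) = (\<Prod>i\<in>UNIV. g (axis i 1, 0)) * g (0, 1)"
proof -
  have notin: "((0, 1) :: (real ^ 'n) \<times> real) \<notin> range (\<lambda>i. (axis i 1, 0))" by auto
  have inj: "inj (\<lambda>i. (axis i 1, 0) :: (real ^ 'n) \<times> real)"
    by (auto simp: inj_on_def axis_eq_axis)
  show "(\<Sum>j\<in>(Basis :: ((real ^ 'n) \<times> real) set). f j) = (\<Sum>i\<in>UNIV. f (axis i 1, 0)) + f (0, 1)"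
    unfolding Basis_vec_real using notin inj by (simp add: sum.reindex)
  show "(\<Prod>j\<in>(Basis :: ((real ^ 'n) \<times> real) set). g j) = (\<Prod>i\<in>UNIV. g (axis i 1, 0)) * g (0, 1)"
    unfolding Basis_vec_real using notin inj by (simp add: prod.reindex)
qed

lemma borel_measurable_component [measurable]:
  "(\<lambda>x :: real ^ 'n. x $ i) \<in> borel_measurable borel"
  by (intro borel_measurable_continuous_onI continuous_intros)

text \<open>
  Stated with a preimage, so that measurability is only needed for \<open>X\<close> and not for its image.
\<close>

lemma emeasure_diagonal_affine:
  fixes t d :: "real ^ 'n" and s e :: real
  assumes d: "\<And>i. d $ i \<noteq> 0" and e: "e \<noteq> 0" and X: "X \<in> sets borel"
  shows "emeasure lborel X = ennreal ((\<Prod>i\<in>UNIV. \<bar>d $ i\<bar>) * \<bar>e\<bar>) *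
    emeasure lborel ((\<lambda>(x, y). (\<chi> i. t $ i + d $ i * x $ i, s + e * y)) -` X)"
proof -
  define T where "T z = (t, s) + (\<Sum>j\<in>Basis. (((d, e) \<bullet> j) * (z \<bullet> j)) *\<^sub>R j)"
    for z :: "(real ^ 'n) \<times> real"
  have T: "T = (\<lambda>(x, y). (\<chi> i. t $ i + d $ i * x $ i, s + e * y))"
  proof (rule ext, clarify, rule euclidean_eqI)
    fix x :: "real ^ 'n" and y and j :: "(real ^ 'n) \<times> real"
    assume j: "j \<in> Basis"
    have "T (x, y) \<bullet> j = (t, s) \<bullet> j + ((d, e) \<bullet> j) * ((x, y) \<bullet> j)"
      using j by (simp only: T_def inner_add_left inner_sum_left_Basis)
    thus "T (x, y) \<bullet> j = (\<chi> i. t $ i + d $ i * x $ i, s + e * y) \<bullet> j"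
      using j by (auto simp: Basis_vec_real inner_axis)
  qed
  have nz: "(d, e) \<bullet> j \<noteq> 0" if "j \<in> Basis" for j
    using that d e by (auto simp: Basis_vec_real inner_axis)
  have [measurable]: "T \<in> borel_measurable borel" by (simp add: T_def[abs_def])
  have lborel: "lborel = density (distr lborel borel T) (\<lambda>_. (\<Prod>j\<in>Basis. \<bar>(d, e) \<bullet> j\<bar>))"
    unfolding T_def[abs_def] by (rule lborel_affine_euclidean) (rule nz)
  have "emeasure lborel X
      = emeasure (density (distr lborel borel T) (\<lambda>_. (\<Prod>j\<in>Basis. \<bar>(d, e) \<bullet> j\<bar>))) X"
    by (rule arg_cong[OF lborel])
  also have "\<dots> = ennreal (\<Prod>j\<in>Basis. \<bar>(d, e) \<bullet> j\<bar>) * emeasure lborel (T -` X)"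
    using X by (simp add: emeasure_density nn_integral_cmult emeasure_distr)
  also have "(\<Prod>j\<in>Basis. \<bar>(d, e) \<bullet> j\<bar>) = (\<Prod>i\<in>UNIV. \<bar>d $ i\<bar>) * \<bar>e\<bar>"
    by (simp add: prod_Basis_vec_real inner_axis)
  finally show ?thesis by (simp add: T)
qed

definition swap_coord :: "'n \<Rightarrow> (real ^ 'n) \<times> real \<Rightarrow> (real ^ 'n) \<times> real" where
  "swap_coord l = (\<lambda>(x, y). (\<chi> i. if i = l then y else x $ i, x $ l))"

text \<open>
  The exchange is an involution that permutes the coordinates, so it maps boxes to boxes with the
  same side lengths.
\<close>

lemma emeasure_swap_coord:
  fixes X :: "((real ^ 'n) \<times> real) set"
  assumes X: "X \<in> sets borel"
  shows "emeasure lborel (swap_coord l -` X) = emeasure lborel X"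
proof -
  have cont: "continuous_on UNIV (swap_coord l)"
    unfolding swap_coord_def case_prod_beta
  proof (intro continuous_on_Pair continuous_on_vec_lambda)
    show "continuous_on UNIV (\<lambda>x :: (real ^ 'n) \<times> real. if i = l then snd x else fst x $ i)" for i
      by (cases "i = l") (auto intro!: continuous_intros)
  qed (auto intro!: continuous_intros)
  have [measurable]: "swap_coord l \<in> borel_measurable borel"
    using cont by (rule borel_measurable_continuous_onI)
  have box_measure: "emeasure lborel (box p q) = ennreal (\<Prod>b\<in>Basis. (q - p) \<bullet> b)"
    if "\<And>b. b \<in> Basis \<Longrightarrow> p \<bullet> b \<le> q \<bullet> b" for p q :: "(real ^ 'n) \<times> real"
    using that by (intro emeasure_lborel_box) auto
  have "lborel = distr lborel borel (swap_coord l)"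
  proof (rule lborel_eqI)
    fix p q :: "(real ^ 'n) \<times> real"
    assume pq: "\<And>b. b \<in> Basis \<Longrightarrow> p \<bullet> b \<le> q \<bullet> b"
    obtain x y x' y' where [simp]: "p = (x, y)" "q = (x', y')" by fastforce
    have le: "x $ i \<le> x' $ i" "y \<le> y'" for i
      using pq[of "(axis i 1, 0)"] pq[of "(0, 1)"] by (auto simp: Basis_vec_real inner_axis)
    have "swap_coord l -` box p q = box (swap_coord l p) (swap_coord l q)"
      by (auto simp: swap_coord_def mem_box Basis_vec_real inner_axis split: if_splits)
    hence "emeasure (distr lborel borel (swap_coord l)) (box p q)
        = emeasure lborel (box (swap_coord l p) (swap_coord l q))"
      by (simp add: emeasure_distr)
    also have "\<dots> = ennreal (\<Prod>b\<in>Basis. (swap_coord l q - swap_coord l p) \<bullet> b)"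
      using le by (intro box_measure) (auto simp: Basis_vec_real inner_axis swap_coord_def)
    also have "(\<Prod>b\<in>Basis. (swap_coord l q - swap_coord l p) \<bullet> b)
        = (\<Prod>i\<in>UNIV. if i = l then y' - y else x' $ i - x $ i) * (x' $ l - x $ l)"
      by (auto simp: prod_Basis_vec_real swap_coord_def inner_axis intro!: prod.cong)
    also have "\<dots> = (y' - y) * (\<Prod>i\<in>UNIV - {l}. x' $ i - x $ i) * (x' $ l - x $ l)"
      by (subst prod.remove[of UNIV l]) (auto intro!: prod.cong)
    also have "\<dots> = (\<Prod>i\<in>UNIV. x' $ i - x $ i) * (y' - y)"
      by (simp add: prod.remove[of UNIV l "\<lambda>i. x' $ i - x $ i"])
    also have "\<dots> = (\<Prod>b\<in>Basis. (q - p) \<bullet> b)"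
      by (simp add: prod_Basis_vec_real inner_axis)
    finally show "emeasure (distr lborel borel (swap_coord l)) (box p q) = (\<Prod>b\<in>Basis. (q - p) \<bullet> b)" .
  qed simp
  hence "emeasure lborel X = emeasure (distr lborel borel (swap_coord l)) X" by simp
  also have "\<dots> = emeasure lborel (swap_coord l -` X)"
    using X by (simp add: emeasure_distr)
  finally show ?thesis by simp
qed

section \<open>Integrals of the Frechet bounds\<close>


lemma measure_between_graphs:
  fixes f g :: "'a::euclidean_space \<Rightarrow> real"
  assumes [measurable]: "S \<in> sets borel" "f \<in> borel_measurable borel" "g \<in> borel_measurable borel"
    and le: "\<And>x. x \<in> S \<Longrightarrow> f x \<le> g x"
  shows "{(x, y). x \<in> S \<and> f x \<le> y \<and> y \<le> g x} \<in> sets borel" (is "?A \<in> _")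
    and "measure lborel {(x, y). x \<in> S \<and> f x \<le> y \<and> y \<le> g x} = (LINT x:S|lborel. g x - f x)"
proof -
  have "{p :: 'a \<times> real \<in> space (borel \<Otimes>\<^sub>M borel). fst p \<in> S \<and> f (fst p) \<le> snd p \<and> snd p \<le> g (fst p)}
      \<in> sets (borel \<Otimes>\<^sub>M borel)" by measurable
  also have "{p :: 'a \<times> real \<in> space (borel \<Otimes>\<^sub>M borel). fst p \<in> S \<and> f (fst p) \<le> snd p \<and> snd p \<le> g (fst p)} = ?A"
    by (auto simp: space_pair_measure)
  finally have A: "?A \<in> sets (borel \<Otimes>\<^sub>M borel)" .
  thus "?A \<in> sets borel" by (simp only: borel_prod)
  have A': "?A \<in> sets (lborel \<Otimes>\<^sub>M lborel)"
    using A by (simp cong: sets_pair_measure_cong)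
  have "emeasure lborel ?A = emeasure (lborel \<Otimes>\<^sub>M lborel) ?A"
    by (simp only: lborel_prod)
  also have "\<dots> = (\<integral>\<^sup>+ x. emeasure lborel (Pair x -` ?A) \<partial>lborel)"
    by (rule lborel.emeasure_pair_measure_alt[OF A'])
  also have "\<dots> = (\<integral>\<^sup>+ x. ennreal (indicator S x *\<^sub>R (g x - f x)) \<partial>lborel)"
  proof (rule nn_integral_cong)
    fix x
    have "Pair x -` ?A = (if x \<in> S then {f x..g x} else {})" by auto
    thus "emeasure lborel (Pair x -` ?A) = ennreal (indicator S x *\<^sub>R (g x - f x))"
      using le[of x] by auto
  qed
  finally have "measure lborel ?A = enn2real (\<integral>\<^sup>+ x. ennreal (indicator S x *\<^sub>R (g x - f x)) \<partial>lborel)"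
    by (simp add: measure_def)
  also have "\<dots> = (LINT x|lborel. indicator S x *\<^sub>R (g x - f x))"
    by (rule integral_eq_nn_integral[symmetric])
      (use le in \<open>auto simp: indicator_def intro!: AE_I2\<close>)
  finally show "measure lborel ?A = (LINT x:S|lborel. g x - f x)"
    by (simp add: set_lebesgue_integral_def)
qed

lemma frechet_measurable [measurable]:
  fixes I :: "'n::finite set"
  shows "frechet_upper I \<in> borel_measurable borel" "frechet_lower I \<in> borel_measurable borel"
  unfolding frechet_upper_def[abs_def] frechet_lower_def[abs_def] by measurable

lemma frechet_between_0_1:
  fixes I :: "'n::finite set"
  assumes u: "u \<in> cbox 0 1"
  shows "I \<noteq> {} \<Longrightarrow> 0 \<le> frechet_upper I u" "I \<noteq> {} \<Longrightarrow> frechet_upper I u \<le> 1"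
    "0 \<le> frechet_lower I u" "frechet_lower I u \<le> 1"
proof -
  have 01: "0 \<le> u $ i" "u $ i \<le> 1" for i using u by (auto simp: mem_unit_cube)
  show "0 \<le> frechet_upper I u" if "I \<noteq> {}"
    using that 01 by (auto intro: frechet_upper_greatest)
  show "frechet_upper I u \<le> 1" if I: "I \<noteq> {}"
  proof -
    obtain i where "frechet_upper I u = u $ i" using frechet_upper_attained[OF I] .
    thus ?thesis using 01 by simp
  qed
  show "0 \<le> frechet_lower I u" by (simp add: frechet_lower_def)
  have "0 \<le> (\<Sum>i\<in>I. 1 - u $ i)" by (rule sum_nonneg) (use 01 in auto)
  thus "frechet_lower I u \<le> 1" by (simp add: frechet_lower_def)
qed

lemma frechet_integrable:
  fixes I :: "'n::finite set"
  shows "I \<noteq> {} \<Longrightarrow> set_integrable lborel (cbox 0 1) (frechet_upper I)"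
    and "set_integrable lborel (cbox 0 1) (frechet_lower I)"
  unfolding set_integrable_def
  by (rule integrableI_bounded_set_indicator[where B = 1];
      use frechet_between_0_1[of _ I] in \<open>auto intro!: AE_I2 simp: emeasure_lborel_cbox_eq\<close>)+

text \<open>
  Slice the region below the graph horizontally: at height \<open>y\<close> the slice is a box whose sides with
  index in \<open>I\<close> have length \<open>1 - y\<close>, so the integral is that of \<open>(1 - y)\<^sup>k\<close> over \<open>[0, 1]\<close> with \<open>k = |I|\<close>.
\<close>

lemma integral_frechet_upper:
  fixes I :: "'n::finite set"
  assumes I: "I \<noteq> {}"
  shows "(LINT u:cbox 0 1|lborel. frechet_upper I u) = 1 / (real (card I) + 1)"
proof -
  let ?k = "card I"
  let ?A = "{(u, y). u \<in> cbox 0 1 \<and> 0 \<le> y \<and> y \<le> frechet_upper I u}"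
  note graph = measure_between_graphs[of "cbox 0 1" "\<lambda>_. 0" "frechet_upper I"]
  have A: "?A \<in> sets (lborel \<Otimes>\<^sub>M lborel)"
    unfolding lborel_prod using graph(1) frechet_between_0_1(1)[OF _ I] by simp
  have slice: "emeasure lborel ((\<lambda>u. (u, y)) -` ?A) = ennreal ((1 - y) ^ ?k) * indicator {0..1} y" for y
  proof (cases "y \<in> {0..1}")
    case True
    have "(\<lambda>u. (u, y)) -` ?A = cbox (\<chi> i. if i \<in> I then y else 0) 1"
    proof (rule set_eqI)
      fix u :: "real ^ 'n"
      have "y \<le> frechet_upper I u \<longleftrightarrow> (\<forall>i\<in>I. y \<le> u $ i)"
        using I frechet_upper_le[of _ I u] frechet_upper_greatest[OF I, of y u] by force
      thus "u \<in> (\<lambda>u. (u, y)) -` ?A \<longleftrightarrow> u \<in> cbox (\<chi> i. if i \<in> I then y else 0) 1"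
        using True by (auto simp: mem_box_cart split: if_splits)
    qed
    moreover have "emeasure lborel (cbox (\<chi> i. if i \<in> I then y else 0) (1 :: real ^ 'n)) =
        ennreal (measure lborel (cbox (\<chi> i. if i \<in> I then y else 0) (1 :: real ^ 'n)))"
      by (rule emeasure_eq_ennreal_measure) (simp add: emeasure_lborel_cbox_eq)
    moreover have "measure lborel (cbox (\<chi> i. if i \<in> I then y else 0) (1 :: real ^ 'n)) =
        (\<Prod>i\<in>UNIV. 1 - (if i \<in> I then y else 0))"
    proof -
      have "1 \<in> cbox (\<chi> i. if i \<in> I then y else 0) (1 :: real ^ 'n)"
        using True by (auto simp: mem_box_cart)
      hence "cbox (\<chi> i. if i \<in> I then y else 0) (1 :: real ^ 'n) \<noteq> {}" by blast
      thus ?thesis by (simp add: content_cbox_cart)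
    qed
    moreover have "\<dots> = (\<Prod>i\<in>UNIV. if i \<in> I then 1 - y else 1)"
      by (rule prod.cong) auto
    moreover have "\<dots> = (1 - y) ^ ?k" by (simp add: prod.If_cases)
    ultimately show ?thesis using True by simp
  next
    case False
    have empty: "(\<lambda>u. (u, y)) -` ?A = {}"
      using False frechet_between_0_1(2)[OF _ I] by force
    show ?thesis unfolding empty using False by (auto simp: indicator_def)
  qed
  have "emeasure lborel ?A = emeasure (lborel \<Otimes>\<^sub>M lborel) ?A"
    by (simp only: lborel_prod)
  also have "\<dots> = (\<integral>\<^sup>+ y. ennreal ((1 - y) ^ ?k) * indicator {0..1} y \<partial>lborel)"
    by (subst lborel_pair.emeasure_pair_measure_alt2[OF A]) (simp only: slice)
  also have "\<dots> = ennreal (- ((1 - 1) ^ Suc ?k / (real ?k + 1)) - - ((1 - 0) ^ Suc ?k / (real ?k + 1)))"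
  proof (rule nn_integral_FTC_Icc)
    fix y :: real
    have "((\<lambda>y. (1 - y) ^ Suc ?k) has_real_derivative real (Suc ?k) * (1 - y) ^ ?k * (- 1)) (at y)"
      by (auto intro!: derivative_eq_intros simp del: power_Suc)
    from DERIV_minus[OF DERIV_cdivide[OF this]]
    have "((\<lambda>y. - ((1 - y) ^ Suc ?k / (real ?k + 1))) has_real_derivative
        - ((real (Suc ?k) * (1 - y) ^ ?k * (- 1)) / (real ?k + 1))) (at y)" .
    also have "- ((real (Suc ?k) * (1 - y) ^ ?k * (- 1)) / (real ?k + 1)) = (1 - y) ^ ?k"
      by (simp add: field_simps)
    finally show "((\<lambda>y. - ((1 - y) ^ Suc ?k / (real ?k + 1))) has_real_derivative (1 - y) ^ ?k) (at y)" .
  qed auto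
  finally have "measure lborel ?A = 1 / (real ?k + 1)"
    by (simp add: measure_def)
  moreover have "measure lborel ?A = (LINT u:cbox 0 1|lborel. frechet_upper I u - 0)"
    by (rule graph(2)) (use frechet_between_0_1(1)[OF _ I] in auto)
  ultimately show ?thesis by simp
qed

text \<open>
  The region below the graph of the lower Frechet bound after the reflection \<open>v = 1 - u\<close>: a
  corner simplex in the coordinates of \<open>I\<close> and the height, times a unit cube in the other coordinates.
\<close>

definition corner :: "'n::finite set \<Rightarrow> ((real ^ 'n) \<times> real) set" where
  "corner I = {(v, y). v \<in> cbox 0 1 \<and> 0 \<le> y \<and> (\<Sum>i\<in>I. v $ i) + y \<le> 1}"

lemma integral_frechet_lower_eq_corner:
  fixes I :: "'n::finite set"
  shows "(LINT u:cbox 0 1|lborel. frechet_lower I u) = measure lborel (corner I)"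
proof -
  \<comment> \<open>Restricting to the set where the affine part is nonnegative removes the maximum, and with it a
    piece of the cube at height \<open>0\<close> that does not belong to the corner.\<close>
  define S where "S = {u \<in> cbox 0 (1 :: real ^ 'n). (\<Sum>i\<in>I. 1 - u $ i) \<le> 1}"
  define h where "h u = 1 - (\<Sum>i\<in>I. 1 - u $ i)" for u :: "real ^ 'n"
  let ?R = "{(u, y). u \<in> S \<and> 0 \<le> y \<and> y \<le> h u}"
  have [measurable]: "h \<in> borel_measurable borel"
    unfolding h_def[abs_def] by measurable
  have "S = cbox 0 1 \<inter> {u. 0 \<le> h u}" by (auto simp: S_def h_def)
  also have "\<dots> \<in> sets borel" by measurable
  finally have S [measurable]: "S \<in> sets borel" .
  note graph = measure_between_graphs[of S "\<lambda>_. 0" h]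
  have R: "?R \<in> sets borel" by (rule graph(1)) (auto simp: S_def h_def)
  have "(LINT u:cbox 0 1|lborel. frechet_lower I u) = (LINT u:S|lborel. h u - 0)"
    unfolding set_lebesgue_integral_def
    by (intro Bochner_Integration.integral_cong) (auto simp: S_def h_def frechet_lower_def indicator_def)
  also have "\<dots> = measure lborel ?R"
    by (rule graph(2)[symmetric]) (auto simp: S_def h_def)
  also have "\<dots> = measure lborel (corner I)"
  proof -
    have "emeasure lborel ?R = ennreal ((\<Prod>i\<in>UNIV. \<bar>(-1 :: real ^ 'n) $ i\<bar>) * \<bar>1\<bar>) *
      emeasure lborel ((\<lambda>(x, y). (\<chi> i. (1 :: real ^ 'n) $ i + (-1 :: real ^ 'n) $ i * x $ i, 0 + 1 * y)) -` ?R)"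
      by (rule emeasure_diagonal_affine) (use R in auto)
    also have "(\<lambda>(x, y). (\<chi> i. (1 :: real ^ 'n) $ i + (-1 :: real ^ 'n) $ i * x $ i, 0 + 1 * y)) -` ?R = corner I"
      by (auto simp: S_def h_def corner_def mem_unit_cube)
    finally show ?thesis by (simp add: measure_def)
  qed
  finally show ?thesis .
qed

lemma integral_frechet_lower_UNIV:
  "(LINT u:cbox 0 1|lborel. frechet_lower (UNIV :: 'n::finite set) u) = 1 / fact (CARD('n) + 1)"
proof -
  have "corner (UNIV :: 'n set) = convex hull (insert 0 Basis)"
  proof (rule set_eqI, clarify)
    fix v :: "real ^ 'n" and y :: real
    have le1: "v $ k \<le> 1" if "\<And>i. 0 \<le> v $ i" "0 \<le> y" "(\<Sum>i\<in>UNIV. v $ i) + y \<le> 1" for k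
      using member_le_sum[of k UNIV "\<lambda>i. v $ i"] that by simp
    have "(v, y) \<in> convex hull (insert 0 Basis) \<longleftrightarrow>
        (\<forall>i. 0 \<le> v $ i) \<and> 0 \<le> y \<and> (\<Sum>i\<in>UNIV. v $ i) + y \<le> 1"
      unfolding std_simplex mem_Collect_eq sum_Basis_vec_real
      by (auto simp: Basis_vec_real inner_axis)
    thus "(v, y) \<in> corner UNIV \<longleftrightarrow> (v, y) \<in> convex hull (insert 0 Basis)"
      using le1 by (auto simp: corner_def mem_unit_cube)
  qed
  thus ?thesis
    by (simp add: integral_frechet_lower_eq_corner content_std_simplex)
qed

text \<open>
  The region below the graph is a prism: coordinate \<open>l\<close> is free in \<open>[0, 1]\<close>, and the other coordinates and the
  height form a simplex of dimension \<open>n\<close>. Exchanging coordinate \<open>l\<close> with the height turns it into the product of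
  the standard simplex of \<open>real ^ 'n\<close> and a unit interval.
\<close>

lemma integral_frechet_lower_remove:
  "(LINT u:cbox 0 1|lborel. frechet_lower (- {l :: 'n::finite}) u) = 1 / fact (CARD('n))"
proof -
  define D where "D = convex hull (insert 0 Basis :: (real ^ 'n) set)"
  have D: "v \<in> D \<longleftrightarrow> (\<forall>i. 0 \<le> v $ i) \<and> (\<Sum>i\<in>UNIV. v $ i) \<le> 1" for v
    unfolding D_def std_simplex mem_Collect_eq
    by (simp add: Basis_vec_def UNION_singleton_eq_range sum.reindex inj_on_def axis_eq_axis inner_axis)
  have "compact D"
    unfolding D_def by (intro finite_imp_compact_convex_hull) auto
  hence Db: "D \<in> sets borel" by (intro borel_closed compact_imp_closed)
  have "corner (- {l}) = swap_coord l -` (D \<times> {0..1})"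
  proof (rule set_eqI, clarify)
    fix v :: "real ^ 'n" and y :: real
    have sum: "(\<Sum>i\<in>UNIV. if i = l then y else v $ i) = y + (\<Sum>i\<in>- {l}. v $ i)"
      by (subst sum.remove[of UNIV l]) (auto simp: Compl_eq_Diff_UNIV intro!: sum.cong)
    have le1: "v $ k \<le> 1"
      if "k \<noteq> l" "\<And>i. i \<noteq> l \<Longrightarrow> 0 \<le> v $ i" "0 \<le> y" "(\<Sum>i\<in>- {l}. v $ i) + y \<le> 1" for k
      using member_le_sum[of k "- {l}" "\<lambda>i. v $ i"] that by simp
    have "(v, y) \<in> swap_coord l -` (D \<times> {0..1}) \<longleftrightarrow>
      (\<forall>i. i \<noteq> l \<longrightarrow> 0 \<le> v $ i) \<and> 0 \<le> y \<and> (\<Sum>i\<in>- {l}. v $ i) + y \<le> 1 \<and> 0 \<le> v $ l \<and> v $ l \<le> 1"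
      by (auto simp: swap_coord_def D sum add.commute split: if_splits)
    also have "\<dots> \<longleftrightarrow> (v, y) \<in> corner (- {l})"
      unfolding corner_def mem_unit_cube mem_Collect_eq case_prod_conv using le1 by metis
    finally show "(v, y) \<in> corner (- {l}) \<longleftrightarrow> (v, y) \<in> swap_coord l -` (D \<times> {0..1})" by blast
  qed
  hence "emeasure lborel (corner (- {l})) = emeasure lborel (D \<times> {0..1::real})"
    using Db by (simp add: emeasure_swap_coord borel_Times)
  also have "\<dots> = emeasure (lborel \<Otimes>\<^sub>M lborel) (D \<times> {0..1::real})"
    by (simp only: lborel_prod)
  also have "\<dots> = emeasure lborel D * emeasure lborel {0..1::real}"
    using Db by (intro lborel.emeasure_pair_measure_Times) auto
  also have "\<dots> = ennreal (1 / fact CARD('n))"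
    unfolding D_def emeasure_std_simplex by simp
  finally show ?thesis
    by (simp add: integral_frechet_lower_eq_corner measure_def)
qed

section \<open>The volume of the hull\<close>


lemma measure_unit_hull:
  fixes l :: "'n::finite"
  assumes "-{l} \<noteq> {}" and nonneg: "0 \<le> \<alpha>" "0 \<le> \<delta>"
  shows "measure lborel (unit_hull l \<alpha> \<delta>) =
    \<alpha> * (1 / real CARD('n) - 1 / fact CARD('n)) +
    \<delta> * (1 / (real CARD('n) + 1) - 1 / fact (CARD('n) + 1))"
proof -
  note upper = frechet_integrable(1)[OF assms(1)] frechet_integrable(1)[OF UNIV_not_empty]
  note lower = frechet_integrable(2)
  have [measurable]: "upper_envelope l \<alpha> \<delta> \<in> borel_measurable borel"
    "lower_envelope l \<alpha> \<delta> \<in> borel_measurable borel"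
    unfolding upper_envelope_def[abs_def] lower_envelope_def[abs_def] by measurable
  have card: "real (card (- {l})) + 1 = real CARD('n)"
    using zero_less_card_finite[where 'a = 'n] by (simp add: Compl_eq_Diff_UNIV of_nat_diff)
  have "measure lborel (unit_hull l \<alpha> \<delta>)
      = (LINT u:cbox 0 1|lborel. upper_envelope l \<alpha> \<delta> u - lower_envelope l \<alpha> \<delta> u)"
    unfolding unit_hull_eq[OF assms]
  proof (rule measure_between_graphs(2))
    fix u :: "real ^ 'n" assume u: "u \<in> cbox 0 1"
    have "frechet_lower I u \<le> frechet_upper I u" if "I \<noteq> {}" for I
      using frechet_bounds[OF u, of I] that by simp
    thus "lower_envelope l \<alpha> \<delta> u \<le> upper_envelope l \<alpha> \<delta> u"
      unfolding lower_envelope_def upper_envelope_def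
      using assms by (intro add_mono mult_left_mono) auto
  qed auto
  also have "\<dots> = \<alpha> * (LINT u:cbox 0 1|lborel. frechet_upper (- {l}) u) +
      \<delta> * (LINT u:cbox 0 1|lborel. frechet_upper (UNIV :: 'n set) u) -
      (\<alpha> * (LINT u:cbox 0 1|lborel. frechet_lower (- {l}) u) +
      \<delta> * (LINT u:cbox 0 1|lborel. frechet_lower (UNIV :: 'n set) u))"
    unfolding upper_envelope_def lower_envelope_def
    by (simp add: set_integral_diff(2) set_integral_add set_integrable_mult_right upper lower)
  also have "\<dots> = \<alpha> * (1 / real CARD('n)) + \<delta> * (1 / (real CARD('n) + 1)) -
      (\<alpha> * (1 / fact CARD('n)) + \<delta> * (1 / fact (CARD('n) + 1)))"
    by (simp only: integral_frechet_upper[OF assms(1)] integral_frechet_upper[OF UNIV_not_empty]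
        integral_frechet_lower_UNIV integral_frechet_lower_remove card)
  finally show ?thesis by (simp add: right_diff_distrib)
qed

lemma prod_rescaled_box:
  fixes a b u :: "real ^ 'n"
  assumes "\<And>i. i \<noteq> l \<Longrightarrow> a $ i = 0"
  shows "(\<Prod>i\<in>UNIV. a $ i + (b $ i - a $ i) * u $ i)
    = (\<Prod>i\<in>-{l}. b $ i) * monomial_pair l (a $ l) (b $ l - a $ l) u"
proof -
  have split: "(\<Prod>i\<in>UNIV. f i) = f l * (\<Prod>i\<in>-{l}. f i)" for f :: "'n \<Rightarrow> real"
    by (simp add: prod.remove[of UNIV l] Compl_eq_Diff_UNIV)
  have "(\<Prod>i\<in>-{l}. a $ i + (b $ i - a $ i) * u $ i) = (\<Prod>i\<in>-{l}. b $ i * u $ i)"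
    by (rule prod.cong) (use assms in auto)
  hence "(\<Prod>i\<in>UNIV. a $ i + (b $ i - a $ i) * u $ i)
      = (a $ l + (b $ l - a $ l) * u $ l) * ((\<Prod>i\<in>-{l}. b $ i) * (\<Prod>i\<in>-{l}. u $ i))"
    unfolding split[of "\<lambda>i. a $ i + (b $ i - a $ i) * u $ i"] by (simp add: prod.distrib)
  thus ?thesis
    unfolding monomial_pair_def split[of "\<lambda>i. u $ i"] by (simp add: algebra_simps)
qed

text \<open>
  Affine maps commute with convex hulls, and this one carries the normalised graph onto the graph of
  the monomial over the box. The summand \<open>0\<close> brings the map into the form of \<open>emeasure_diagonal_affine\<close>.
\<close>

lemma monomial_hull_eq_image:
  fixes a b :: "real ^ 'n"
  assumes "\<And>i. a $ i < b $ i" "\<And>i. i \<noteq> l \<Longrightarrow> a $ i = 0"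
  shows "monomial_hull a b =
    (\<lambda>(u, y). (\<chi> i. a $ i + (b $ i - a $ i) * u $ i, 0 + (\<Prod>i\<in>-{l}. b $ i) * y)) `
      unit_hull l (a $ l) (b $ l - a $ l)"
proof -
  define B where "B = (\<Prod>i\<in>-{l}. b $ i)"
  define A where "A = (\<lambda>(u, y). (\<chi> i. (b $ i - a $ i) * u $ i, B * y) :: (real ^ 'n) \<times> real)"
  have "linear A"
    by (rule linearI) (auto simp: A_def vec_eq_iff algebra_simps)
  have T: "(\<lambda>(u, y). (\<chi> i. a $ i + (b $ i - a $ i) * u $ i, 0 + B * y)) = (\<lambda>p. (a, 0) + A p)"
    by (auto simp: A_def fun_eq_iff vec_eq_iff)
  have "{(x, y). (\<forall>i. a $ i \<le> x $ i \<and> x $ i \<le> b $ i) \<and> y = (\<Prod>i\<in>UNIV. x $ i)}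
      = (\<lambda>p. (a, 0) + A p) ` (\<lambda>u. (u, monomial_pair l (a $ l) (b $ l - a $ l) u)) ` cbox 0 1"
    (is "?G = ?H")
  proof (intro equalityI subsetI)
    fix p assume "p \<in> ?G"
    then obtain x where p: "p = (x, \<Prod>i\<in>UNIV. x $ i)" and x: "\<And>i. a $ i \<le> x $ i \<and> x $ i \<le> b $ i"
      by auto
    define u where "u = (\<chi> i. (x $ i - a $ i) / (b $ i - a $ i))"
    have "a $ i + (b $ i - a $ i) * u $ i = x $ i" for i
      using assms(1)[of i] by (simp add: u_def)
    moreover have "u \<in> cbox 0 1"
      using x assms(1) by (simp add: mem_unit_cube u_def divide_le_eq zero_le_divide_iff less_imp_le)
    ultimately show "p \<in> ?H"
      using prod_rescaled_box[OF assms(2), of l b u]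
      by (auto simp: p A_def B_def image_iff vec_eq_iff intro!: bexI[of _ u])
  next
    fix p assume "p \<in> ?H"
    then obtain u where u: "u \<in> cbox 0 1"
      and p: "p = (a, 0) + A (u, monomial_pair l (a $ l) (b $ l - a $ l) u)" by auto
    have "a $ i + (b $ i - a $ i) * u $ i \<le> b $ i \<and> 0 \<le> (b $ i - a $ i) * u $ i" for i
    proof -
      have "a $ i + (b $ i - a $ i) * u $ i \<le> a $ i + (b $ i - a $ i) * 1"
        by (intro add_left_mono mult_left_mono) (use u assms(1)[of i] in \<open>auto simp: mem_unit_cube\<close>)
      also have "\<dots> = b $ i" by simp
      finally have "a $ i + (b $ i - a $ i) * u $ i \<le> b $ i" .
      moreover have "0 \<le> (b $ i - a $ i) * u $ i"
        by (rule mult_nonneg_nonneg) (use u assms(1)[of i] in \<open>auto simp: mem_unit_cube\<close>)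
      ultimately show ?thesis by blast
    qed
    thus "p \<in> ?G"
      using prod_rescaled_box[OF assms(2), of l b u] by (auto simp: p A_def B_def)
  qed
  hence "monomial_hull a b = convex hull ((+) (a, 0) ` A `
      (\<lambda>u. (u, monomial_pair l (a $ l) (b $ l - a $ l) u)) ` cbox 0 1)"
    by (simp add: monomial_hull_def image_image)
  also have "\<dots> = (+) (a, 0) ` A ` unit_hull l (a $ l) (b $ l - a $ l)"
    by (simp only: convex_hull_translation convex_hull_linear_image[OF \<open>linear A\<close>] unit_hull_def)
  finally show ?thesis
    using T by (simp add: image_image B_def)
qed

lemma compact_unit_hull: "compact (unit_hull l \<alpha> \<delta>)"
  unfolding unit_hull_def monomial_pair_def
  by (intro compact_convex_hull compact_continuous_image continuous_intros compact_cbox)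

theorem theorem2:
  fixes a b :: "real ^ 'n" and l :: 'n and n :: nat
  assumes "n = CARD('n)" and "n \<ge> 2"
    and "\<forall>i. 0 \<le> a $ i \<and> a $ i < b $ i"
    and "\<forall>i. i \<noteq> l \<longrightarrow> a $ i = 0"
  shows "measure lebesgue (monomial_hull a b) =
    (b $ l - a $ l) * (\<Prod>i\<in>UNIV - {l}. (b $ i)\<^sup>2) / fact (n + 1) *
      ((fact n - 1) * b $ l + (fact (n - 1) - real n) * a $ l)"
proof -
  define \<alpha> \<delta> where "\<alpha> = a $ l" and "\<delta> = b $ l - a $ l"
  define B where "B = (\<Prod>i\<in>-{l}. b $ i)"
  define T where "T = (\<lambda>(u, y). (\<chi> i. a $ i + (b $ i - a $ i) * u $ i, 0 + B * y) :: (real ^ 'n) \<times> real)"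
  have pos: "0 < b $ i" for i using assms(3) by (meson le_less_trans)
  have \<alpha>\<delta>: "0 \<le> \<alpha>" "0 < \<delta>" and B: "0 < B"
    using assms(3) pos by (auto simp: \<alpha>_def \<delta>_def B_def intro: prod_pos)
  have card: "card (- {l}) = n - 1" using assms(1) by (simp add: Compl_eq_Diff_UNIV)
  have ne: "- {l} \<noteq> {}" using card assms(2) by force
  have hull: "monomial_hull a b = T ` unit_hull l \<alpha> \<delta>"
    unfolding T_def \<alpha>_def \<delta>_def B_def by (rule monomial_hull_eq_image) (use assms in auto)
  have inj: "inj T"
    using assms(3) B by (auto simp: inj_on_def T_def vec_eq_iff) (metis diff_gt_0_iff_gt less_irrefl)
  have cont: "continuous_on UNIV T"
    unfolding T_def case_prod_beta by (intro continuous_intros)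
  have "compact (monomial_hull a b)"
    unfolding hull by (intro compact_continuous_image compact_unit_hull continuous_on_subset[OF cont]) auto
  hence borel: "monomial_hull a b \<in> sets borel"
    by (intro borel_closed compact_imp_closed)
  have "emeasure lborel (monomial_hull a b) = ennreal ((\<Prod>i\<in>UNIV. \<bar>(b - a) $ i\<bar>) * \<bar>B\<bar>) *
    emeasure lborel ((\<lambda>(x, y). (\<chi> i. a $ i + (b - a) $ i * x $ i, 0 + B * y)) -` monomial_hull a b)"
    by (rule emeasure_diagonal_affine) (use assms(3) B borel in \<open>auto simp: less_imp_neq[symmetric]\<close>)
  also have "(\<lambda>(x, y). (\<chi> i. a $ i + (b - a) $ i * x $ i, 0 + B * y)) -` monomial_hull a b = unit_hull l \<alpha> \<delta>"
    unfolding hull using inj by (simp add: T_def inj_vimage_image_eq)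
  also have "(\<Prod>i\<in>UNIV. \<bar>(b - a) $ i\<bar>) = \<delta> * B"
  proof -
    have "(\<Prod>i\<in>UNIV. \<bar>(b - a) $ i\<bar>) = \<bar>(b - a) $ l\<bar> * (\<Prod>i\<in>-{l}. \<bar>(b - a) $ i\<bar>)"
      by (simp add: prod.remove[of UNIV l] Compl_eq_Diff_UNIV)
    also have "(\<Prod>i\<in>-{l}. \<bar>(b - a) $ i\<bar>) = B"
      unfolding B_def by (rule prod.cong) (use assms(4) pos in \<open>auto simp: less_imp_le\<close>)
    finally show ?thesis using \<alpha>\<delta> by (simp add: \<delta>_def)
  qed
  finally have "measure lborel (monomial_hull a b) = \<delta> * B\<^sup>2 * measure lborel (unit_hull l \<alpha> \<delta>)"
    using \<alpha>\<delta> B by (simp add: measure_def enn2real_mult power2_eq_square)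
  also have "\<dots> = \<delta> * B\<^sup>2 * (\<alpha> * (1 / real n - 1 / fact n) + \<delta> * (1 / (real n + 1) - 1 / fact (n + 1)))"
    using measure_unit_hull[OF ne] \<alpha>\<delta> assms(1) by simp
  also have "\<alpha> * (1 / real n - 1 / fact n) + \<delta> * (1 / (real n + 1) - 1 / fact (n + 1))
      = ((fact n - 1) * b $ l + (fact (n - 1) - real n) * a $ l) / fact (n + 1)"
  proof -
    obtain m where m: "n = Suc m" using assms(2) by (cases n) auto
    define F :: real where "F = fact m"
    have F: "F > 0" by (simp add: F_def)
    have f: "fact n = (real m + 1) * F" "fact (n - 1) = F" "fact (n + 1) = (real m + 2) * (real m + 1) * F"
      by (simp_all add: m F_def algebra_simps)
    have 1: "1 / real n = (real m + 2) * F / fact (n + 1)" "1 / fact n = (real m + 2) / fact (n + 1)"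
      "1 / (real n + 1) = (real m + 1) * F / fact (n + 1)"
      using F unfolding f by (simp_all add: m add.commute)
    have "\<alpha> * ((real m + 2) * F - (real m + 2)) + \<delta> * ((real m + 1) * F - 1)
        = (fact n - 1) * b $ l + (fact (n - 1) - real n) * a $ l"
      unfolding f \<alpha>_def \<delta>_def by (simp add: m algebra_simps)
    thus ?thesis
      unfolding 1 by (simp only: times_divide_eq_right diff_divide_distrib[symmetric] add_divide_distrib[symmetric])
  qed
  also have "B\<^sup>2 = (\<Prod>i\<in>UNIV - {l}. (b $ i)\<^sup>2)"
    by (simp add: B_def prod_power_distrib Compl_eq_Diff_UNIV)
  finally have "measure lborel (monomial_hull a b) =
    (b $ l - a $ l) * (\<Prod>i\<in>UNIV - {l}. (b $ i)\<^sup>2) / fact (n + 1) *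
      ((fact n - 1) * b $ l + (fact (n - 1) - real n) * a $ l)"
    by (simp add: \<delta>_def)
  thus ?thesis using borel by simp
qed

end
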